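(* Consider the multistage stochastic AC optimal power flow setting, the problems $(P)$, $(P_{\mathrm{SOC}})$, $(P')$, $(P'_{\mathrm{SOC}})$, and the family $(\bar v^{\mathrm{Lin}},\bar S^{\mathrm{Lin}})$ described in the context. Assume the network is radial, connected and passive (i.e. $\Re(z_{i,j})\ge0$ and $\Im(z_{i,j})\ge0$ for all $(i,j)\in\mathcal E$) and moreover $$\bar v^{\mathrm{Lin}}_{i,t,\omega}\le\overline v_i\quad\text{for all } i\in\mathcal B,\ t\in\mathcal T,\ \omega\in\Omega,$$ $$\Re(z_{k,l}^*\bar S^{\mathrm{Lin}}_{(i,j),t,\omega})\le0\quad\text{for all }(i,j)\in\mathcal E,\ (k,l)\in\mathcal E_i,\ t\in\mathcal T,\ \omega\in\Omega.$$ For any feasible point $y$ of $(P)$ (resp. $(P_{\mathrm{SOC}})$), define $(s^{\mathrm{Lin}}_0,v^{\mathrm{Lin}},S^{\mathrm{Lin}})$ as the unique solution of the linear system $v^{\mathrm{Lin}}_{0,t,\omega}=1$; $S^{\mathrm{Lin}}_{(i,j),t,\omega}=\sum_{(k,i)\in\mathcal E}S^{\mathrm{Lin}}_{(k,i),t,\omega}+s_{i,t,\omega}$ for $(i,j)\in\mathcal E$; $0=\sum_{(k,0)\in\mathcal E}S^{\mathrm{Lin}}_{(k,0),t,\omega}+s^{\mathrm{Lin}}_{0,t,\omega}$; $v^{\mathrm{Lin}}_{i,t,\omega}-v^{\mathrm{Lin}}_{j,t,\omega}=2\Re(z_{i,j}^*S^{\mathrm{Lin}}_{(i,j),t,\omega})$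 for $(i,j)\in\mathcal E$ (all for every $t\in\mathcal T,\omega\in\Omega$). Then $y'=(y,s^{\mathrm{Lin}}_0,v^{\mathrm{Lin}},S^{\mathrm{Lin}})$ is feasible for $(P')$ (resp. $(P'_{\mathrm{SOC}})$). In particular, $val(P)=val(P')$ and $val(P_{\mathrm{SOC}})=val(P'_{\mathrm{SOC}})$.
   Context: Network. $\mathcal B=\{0,1,\dots,n\}$ is the set of buses, bus $0$ being the slack (reference) bus. $\mathcal E$ is the set of edges. The network is radial and connected: it is a tree, rooted at $0$, with every edge directed towards the root, so for each $i\in\mathcal B\setminus\{0\}$ there is exactly one edge $(i,j)\in\mathcal E$ leaving $i$ ($j$ is the parent of $i$). Edge $(i,j)$ has impedance $z_{i,j}\in\mathbb C$. For a bus $i$, $\mathcal E_i$ is the set of edges of the sub-tree starting from $i$, i.e. edges $(k,l)\in\mathcal E$ with both endpoints among $i$ and its descendants (so the edge from $i$ to its parent is not in $\mathcal E_i$). $z^*$ is the complex conjugate, $\mathbf i^2=-1$. Time and scenarios. $\mathcal T=\{0,1,\dots,T\}$; step $t$ has duration $\Delta_t>0$. $\Omega$ is a finite set of scenarios with given probabilities, and $\mathbb E$ is the corresponding expectation. Each $\omega\in\Omega$ carries an exogenous trajectory $(\xi_{t,\omega})_{t\in\mathcal T}$; $\omega,\omega'$ are indistinguishable up to time $t$ if $\xi_{\tau,\omega}=\xi_{\tau,\omega'}$ for all $\tau\le t$. A family $y=(y_{t,\omega})$ is non-anticipative if $y_{t,\omega}=y_{t,\omega'}$ for all $t$ and all $\omega,\omega'$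 indistinguishable up to time $t$. Data. Real bounds $\underline v_i,\overline v_i$, $\overline{\mathcal I}_{(i,j)}$, $\overline S_{(i,j)}$, $\overline p^{\mathrm{inj}}_i$, $\overline p^{\mathrm{abs}}_i$, $\underline q_i,\overline q_i$, $\underline X_i,\overline X_i$; real efficiencies $\rho^{\mathrm{abs}}_i,\rho^{\mathrm{inj}}_i$; initial states of charge $x_i$; complex exogenous demands $s^d_{i,t,\omega}$. Variables. $y=(s_0,s,p^{\mathrm{inj}},p^{\mathrm{abs}},q,X,S,\mathcal I,v)$, where $s_{0,t,\omega}\in\mathbb C$; for $i\in\mathcal B\setminus\{0\}$, $s_{i,t,\omega}\in\mathbb C$ and $p^{\mathrm{inj}}_{i,t,\omega},p^{\mathrm{abs}}_{i,t,\omega},q_{i,t,\omega},X_{i,t,\omega}\in\mathbb R$; for $(i,j)\in\mathcal E$, $S_{(i,j),t,\omega}\in\mathbb C$ and $\mathcal I_{(i,j),t,\omega}\in\mathbb R$; for $i\in\mathcal B$, $v_{i,t,\omega}\in\mathbb R$. Base constraints, for all $t\in\mathcal T$, $\omega\in\Omega$: (a) $v_{0,t,\omega}=1$, and $\underline v_i\le v_{i,t,\omega}\le\overline v_i$ for $i\ne0$; (b) $0\le\mathcal I_{(i,j),t,\omega}\le\overline{\mathcal I}_{(i,j)}$ and $|S_{(i,j),t,\omega}|\le\overline S_{(i,j)}$ for $(i,j)\in\mathcal E$; (c) $0\le p^{\mathrm{inj}}_{i,t,\omega}\le\overline p^{\mathrm{inj}}_i$, $0\le p^{\mathrm{abs}}_{i,t,\omega}\le\overline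 p^{\mathrm{abs}}_i$, $\underline q_i\le q_{i,t,\omega}\le\overline q_i$ for $i\ne0$; (d) for $i\ne 0$: $X_{i,t+1,\omega}=X_{i,t,\omega}+\rho^{\mathrm{abs}}_i p^{\mathrm{abs}}_{i,t,\omega}\Delta_t-\rho^{\mathrm{inj}}_i p^{\mathrm{inj}}_{i,t,\omega}\Delta_t$ if $t<T$; $X_{i,0,\omega}=x_i$; $\underline X_i\le X_{i,t,\omega}\le\overline X_i$; (e) $s_{i,t,\omega}=p^{\mathrm{inj}}_{i,t,\omega}-p^{\mathrm{abs}}_{i,t,\omega}+\mathbf i q_{i,t,\omega}-s^d_{i,t,\omega}$ for $i\ne0$; (f) $S_{(i,j),t,\omega}=\sum_{(k,i)\in\mathcal E}(S_{(k,i),t,\omega}-z_{k,i}\mathcal I_{(k,i),t,\omega})+s_{i,t,\omega}$ for $(i,j)\in\mathcal E$, and $0=\sum_{(k,0)\in\mathcal E}(S_{(k,0),t,\omega}-z_{k,0}\mathcal I_{(k,0),t,\omega})+s_{0,t,\omega}$; (g) $v_{i,t,\omega}-v_{j,t,\omega}=2\Re(z_{i,j}^*S_{(i,j),t,\omega})-|z_{i,j}|^2\mathcal I_{(i,j),t,\omega}$ for $(i,j)\in\mathcal E$; (h) $y$ is non-anticipative. Non-convex constraint (NC): $v_{i,t,\omega}\mathcal I_{(i,j),t,\omega}=|S_{(i,j),t,\omega}|^2$ for all $(i,j)\in\mathcal E,t,\omega$. Relaxed constraint (SOC): $v_{i,t,\omega}\mathcal I_{(i,j),t,\omega}\ge|S_{(i,j),t,\omega}|^2$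 for all $(i,j)\in\mathcal E,t,\omega$. Restriction constraints, with additional variables $s^{\mathrm{Lin}}_{0,t,\omega}\in\mathbb C$, $v^{\mathrm{Lin}}_{i,t,\omega}\in\mathbb R$ ($i\in\mathcal B$), $S^{\mathrm{Lin}}_{(i,j),t,\omega}\in\mathbb C$ ($(i,j)\in\mathcal E$), for all $t,\omega$: (L1) $v^{\mathrm{Lin}}_{0,t,\omega}=1$; (L2) $v^{\mathrm{Lin}}_{i,t,\omega}\le\overline v_i$ for $i\in\mathcal B$; (L3) $S^{\mathrm{Lin}}_{(i,j),t,\omega}=\sum_{(k,i)\in\mathcal E}S^{\mathrm{Lin}}_{(k,i),t,\omega}+s_{i,t,\omega}$ for $(i,j)\in\mathcal E$; (L4) $0=\sum_{(k,0)\in\mathcal E}S^{\mathrm{Lin}}_{(k,0),t,\omega}+s^{\mathrm{Lin}}_{0,t,\omega}$; (L5) $v^{\mathrm{Lin}}_{i,t,\omega}-v^{\mathrm{Lin}}_{j,t,\omega}=2\Re(z_{i,j}^*S^{\mathrm{Lin}}_{(i,j),t,\omega})$ for $(i,j)\in\mathcal E$; (L6) $\Re(z_{k,l}^*S^{\mathrm{Lin}}_{(i,j),t,\omega})\le0$ for all $(i,j)\in\mathcal E$, $(k,l)\in\mathcal E_i$. Upper-bound linearized flow. Put $\overline s_{i,t,\omega}=\overline p^{\mathrm{inj}}_i+\mathbf i\,\overline q_i-s^d_{i,t,\omega}$ for $i\in\mathcal B\setminus\{0\}$. The real numbers $\bar v^{\mathrm{Lin}}_{i,t,\omega}$ ($i\in\mathcal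 B$) and complex numbers $\bar S^{\mathrm{Lin}}_{(i,j),t,\omega}$ ($(i,j)\in\mathcal E$) are the unique solution of $\bar S^{\mathrm{Lin}}_{(i,j),t,\omega}=\sum_{(k,i)\in\mathcal E}\bar S^{\mathrm{Lin}}_{(k,i),t,\omega}+\overline s_{i,t,\omega}$ for $(i,j)\in\mathcal E$; $\bar v^{\mathrm{Lin}}_{0,t,\omega}=1$; $\bar v^{\mathrm{Lin}}_{i,t,\omega}-\bar v^{\mathrm{Lin}}_{j,t,\omega}=2\Re(z_{i,j}^*\bar S^{\mathrm{Lin}}_{(i,j),t,\omega})$ for $(i,j)\in\mathcal E$ (for all $t,\omega$). Problems. $C$ is a real-valued convex cost function of the decision variables $y$ of a scenario (possibly depending on $\omega$ in a progressively measurable way); it does not depend on the Lin variables. $(P)$: minimize $\mathbb E[C]$ over $y$ subject to (a)–(h) and (NC). $(P_{\mathrm{SOC}})$: minimize $\mathbb E[C]$ over $y$ subject to (a)–(h) and (SOC). $(P')$: minimize $\mathbb E[C]$ over $(y,S^{\mathrm{Lin}},v^{\mathrm{Lin}},s^{\mathrm{Lin}}_0)$ (with all variables non-anticipative) subject to (a)–(h), (NC) and (L1)–(L6). $(P'_{\mathrm{SOC}})$: the same as $(P')$ with (NC) replaced by (SOC). $val(\cdot)\in[-\infty,+\infty]$ is the infimum ($+\infty$ if infeasible). *)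

theory Defs
  imports "HOL-Probability.Probability" "HOL-Library.Function_Algebras"
begin

text \<open>
  Pointwise scalar multiplication on functions, so that families of decision variables form a
  real vector space and \<^const>\<open>convex_on\<close> applies to cost functions.
\<close>

instantiation "fun" :: (type, real_vector) real_vector
begin

definition scaleR_fun :: "real \<Rightarrow> ('a \<Rightarrow> 'b) \<Rightarrow> 'a \<Rightarrow> 'b" where
  "scaleR_fun r f = (\<lambda>x. r *\<^sub>R f x)"

instance
  by standard (simp_all add: scaleR_fun_def fun_eq_iff scaleR_add_right scaleR_add_left)

end

text \<open>
  The decision variables \<open>(s\<^sub>0, s, p\<^sup>i\<^sup>n\<^sup>j, p\<^sup>a\<^sup>b\<^sup>s, q, X, S, I, v)\<close> of one time step and one scenario.
  Buses are natural numbers and an edge \<open>(i, j)\<close> is a pair of buses. The variables \<open>I\<close> and \<open>v\<close> stand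
  for squared magnitudes of current and voltage.
\<close>

datatype decision = Decision
  (slack_power: complex)
  (bus_power: "nat \<Rightarrow> complex")
  (p_inj: "nat \<Rightarrow> real")
  (p_abs: "nat \<Rightarrow> real")
  (q_react: "nat \<Rightarrow> real")
  (charge: "nat \<Rightarrow> real")
  (flow: "nat \<times> nat \<Rightarrow> complex")
  (current: "nat \<times> nat \<Rightarrow> real")
  (volt: "nat \<Rightarrow> real")

instantiation decision :: real_vector
begin

definition zero_decision :: decision where
  "0 = Decision 0 0 0 0 0 0 0 0 0"

definition plus_decision :: "decision \<Rightarrow> decision \<Rightarrow> decision" where
  "d + e = Decision (slack_power d + slack_power e) (bus_power d + bus_power e)
     (p_inj d + p_inj e) (p_abs d + p_abs e) (q_react d + q_react e) (charge d + charge e)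
     (flow d + flow e) (current d + current e) (volt d + volt e)"

definition scaleR_decision :: "real \<Rightarrow> decision \<Rightarrow> decision" where
  "r *\<^sub>R d = Decision (r *\<^sub>R slack_power d) (r *\<^sub>R bus_power d)
     (r *\<^sub>R p_inj d) (r *\<^sub>R p_abs d) (r *\<^sub>R q_react d) (r *\<^sub>R charge d)
     (r *\<^sub>R flow d) (r *\<^sub>R current d) (r *\<^sub>R volt d)"

definition uminus_decision :: "decision \<Rightarrow> decision" where
  "- d = (-1) *\<^sub>R (d :: decision)"

definition minus_decision :: "decision \<Rightarrow> decision \<Rightarrow> decision" where
  "d - e = d + - (e :: decision)"

instance
  by standard
    (simp_all add: zero_decision_def plus_decision_def scaleR_decision_def uminus_decision_def
      minus_decision_def decision.expand add.assoc add.commute scaleR_add_right scaleR_add_left)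

end

text \<open>The additional variables \<open>(s\<^sub>0, v, S)\<close> of the linearized flow, for one time step and one scenario.\<close>

datatype lin_state = Lin_State
  (lin_slack_power: complex)
  (lin_volt: "nat \<Rightarrow> real")
  (lin_flow: "nat \<times> nat \<Rightarrow> complex")

text \<open>
  Problem data. The scenario set is the type \<^typ>\<open>'w\<close>, taken to be of class \<^class>\<open>finite\<close> where the
  data are used, and \<^typ>\<open>'x\<close> is the value space of the exogenous process. A cost function takes a
  scenario and the trajectory (indexed by time) of the decision variables in that scenario.
\<close>

record ('w, 'x) opf =
  num_buses :: nat
  edges :: "(nat \<times> nat) set"
  impedance :: "nat \<times> nat \<Rightarrow> complex"
  horizon :: nat
  duration :: "nat \<Rightarrow> real"
  scenario_law :: "'w pmf"
  exo :: "'w \<Rightarrow> nat \<Rightarrow> 'x"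
  volt_min :: "nat \<Rightarrow> real"
  volt_max :: "nat \<Rightarrow> real"
  current_max :: "nat \<times> nat \<Rightarrow> real"
  flow_max :: "nat \<times> nat \<Rightarrow> real"
  p_inj_max :: "nat \<Rightarrow> real"
  p_abs_max :: "nat \<Rightarrow> real"
  q_min :: "nat \<Rightarrow> real"
  q_max :: "nat \<Rightarrow> real"
  charge_min :: "nat \<Rightarrow> real"
  charge_max :: "nat \<Rightarrow> real"
  eff_abs :: "nat \<Rightarrow> real"
  eff_inj :: "nat \<Rightarrow> real"
  charge_init :: "nat \<Rightarrow> real"
  demand :: "'w \<Rightarrow> nat \<Rightarrow> nat \<Rightarrow> complex"
  cost :: "'w \<Rightarrow> (nat \<Rightarrow> decision) \<Rightarrow> real"

definition buses :: "('w, 'x) opf \<Rightarrow> nat set" where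
  "buses D = {0..num_buses D}"

definition load_buses :: "('w, 'x) opf \<Rightarrow> nat set" where
  "load_buses D = {1..num_buses D}"

text \<open>
  A tree on the buses, rooted at bus 0, with all edges directed towards the root: every bus other
  than the root has exactly one parent, the root has none, and following parents leads to the root.
\<close>

definition radial_connected :: "('w, 'x) opf \<Rightarrow> bool" where
  "radial_connected D \<longleftrightarrow>
     edges D \<subseteq> buses D \<times> buses D \<and>
     (\<forall>i\<in>load_buses D. \<exists>!j. (i, j) \<in> edges D) \<and>
     (\<forall>j. (0, j) \<notin> edges D) \<and>
     (\<forall>i\<in>buses D. (i, 0) \<in> (edges D)\<^sup>*)"

definition passive_network :: "('w, 'x) opf \<Rightarrow> bool" where
  "passive_network D \<longleftrightarrow> (\<forall>e\<in>edges D. Re (impedance D e) \<ge> 0 \<and> Im (impedance D e) \<ge> 0)"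

text \<open>Edges with both endpoints among \<open>i\<close> and its descendants.\<close>

definition subtree_edges :: "('w, 'x) opf \<Rightarrow> nat \<Rightarrow> (nat \<times> nat) set" where
  "subtree_edges D i = {(k, l) \<in> edges D. (k, i) \<in> (edges D)\<^sup>* \<and> (l, i) \<in> (edges D)\<^sup>*}"

definition indistinguishable :: "('w, 'x) opf \<Rightarrow> nat \<Rightarrow> 'w \<Rightarrow> 'w \<Rightarrow> bool" where
  "indistinguishable D t \<omega> \<omega>' \<longleftrightarrow> (\<forall>\<tau>\<le>t. exo D \<omega> \<tau> = exo D \<omega>' \<tau>)"

definition non_anticipative :: "('w, 'x) opf \<Rightarrow> ('w \<Rightarrow> nat \<Rightarrow> 'a) \<Rightarrow> bool" where
  "non_anticipative D y \<longleftrightarrow>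
     (\<forall>t\<le>horizon D. \<forall>\<omega> \<omega>'. indistinguishable D t \<omega> \<omega>' \<longrightarrow> y \<omega> t = y \<omega>' t)"

text \<open>
  Families indexed by buses, edges and time steps are total functions that vanish outside their
  index sets, so that a cost function depends on actual decision variables only and solutions of
  linear systems can be unique.
\<close>

definition decision_space :: "('w, 'x) opf \<Rightarrow> decision set" where
  "decision_space D = {d.
     (\<forall>i. i \<notin> load_buses D \<longrightarrow>
        bus_power d i = 0 \<and> p_inj d i = 0 \<and> p_abs d i = 0 \<and> q_react d i = 0 \<and> charge d i = 0) \<and>
     (\<forall>e. e \<notin> edges D \<longrightarrow> flow d e = 0 \<and> current d e = 0) \<and>
     (\<forall>i. i \<notin> buses D \<longrightarrow> volt d i = 0)}"

definition trajectory_space :: "('w, 'x) opf \<Rightarrow> (nat \<Rightarrow> decision) set" where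
  "trajectory_space D = {u. (\<forall>t\<le>horizon D. u t \<in> decision_space D) \<and> (\<forall>t>horizon D. u t = 0)}"

definition lin_state_space :: "('w, 'x) opf \<Rightarrow> lin_state set" where
  "lin_state_space D = {l.
     (\<forall>i. i \<notin> buses D \<longrightarrow> lin_volt l i = 0) \<and> (\<forall>e. e \<notin> edges D \<longrightarrow> lin_flow l e = 0)}"

definition lin_trajectory_space :: "('w, 'x) opf \<Rightarrow> (nat \<Rightarrow> lin_state) set" where
  "lin_trajectory_space D =
     {u. (\<forall>t\<le>horizon D. u t \<in> lin_state_space D) \<and> (\<forall>t>horizon D. u t = Lin_State 0 0 0)}"

text \<open>
  The cost is convex in the decision variables of a scenario, and depends on the scenario through
  the exogenous trajectory up to the horizon only.
\<close>

definition convex_measurable_cost :: "('w, 'x) opf \<Rightarrow> bool" where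
  "convex_measurable_cost D \<longleftrightarrow>
     (\<forall>\<omega>. convex_on (trajectory_space D) (cost D \<omega>)) \<and>
     (\<forall>\<omega> \<omega>'. indistinguishable D (horizon D) \<omega> \<omega>' \<longrightarrow>
        (\<forall>u\<in>trajectory_space D. cost D \<omega> u = cost D \<omega>' u))"

definition bounds_ok :: "('w, 'x) opf \<Rightarrow> decision \<Rightarrow> bool" where
  "bounds_ok D d \<longleftrightarrow>
     volt d 0 = 1 \<and>
     (\<forall>i\<in>load_buses D.
        volt_min D i \<le> volt d i \<and> volt d i \<le> volt_max D i \<and>
        0 \<le> p_inj d i \<and> p_inj d i \<le> p_inj_max D i \<and>
        0 \<le> p_abs d i \<and> p_abs d i \<le> p_abs_max D i \<and>
        q_min D i \<le> q_react d i \<and> q_react d i \<le> q_max D i \<and>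
        charge_min D i \<le> charge d i \<and> charge d i \<le> charge_max D i) \<and>
     (\<forall>e\<in>edges D.
        0 \<le> current d e \<and> current d e \<le> current_max D e \<and> cmod (flow d e) \<le> flow_max D e)"

definition storage_dynamics :: "('w, 'x) opf \<Rightarrow> (nat \<Rightarrow> decision) \<Rightarrow> bool" where
  "storage_dynamics D u \<longleftrightarrow>
     (\<forall>i\<in>load_buses D.
        charge (u 0) i = charge_init D i \<and>
        (\<forall>t<horizon D. charge (u (t + 1)) i =
           charge (u t) i + eff_abs D i * p_abs (u t) i * duration D t
             - eff_inj D i * p_inj (u t) i * duration D t))"

text \<open>Here \<open>sd\<close> is the vector of demands at the time step and scenario under consideration.\<close>

definition power_injection :: "('w, 'x) opf \<Rightarrow> (nat \<Rightarrow> complex) \<Rightarrow> decision \<Rightarrow> bool" where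
  "power_injection D sd d \<longleftrightarrow>
     (\<forall>i\<in>load_buses D.
        bus_power d i = of_real (p_inj d i) - of_real (p_abs d i) + \<i> * of_real (q_react d i) - sd i)"

definition branch_flow :: "('w, 'x) opf \<Rightarrow> decision \<Rightarrow> bool" where
  "branch_flow D d \<longleftrightarrow>
     (\<forall>(i, j)\<in>edges D.
        flow d (i, j) =
          (\<Sum>k | (k, i) \<in> edges D. flow d (k, i) - impedance D (k, i) * of_real (current d (k, i)))
          + bus_power d i) \<and>
     0 = (\<Sum>k | (k, 0) \<in> edges D. flow d (k, 0) - impedance D (k, 0) * of_real (current d (k, 0)))
         + slack_power d \<and>
     (\<forall>(i, j)\<in>edges D.
        volt d i - volt d j =
          2 * Re (cnj (impedance D (i, j)) * flow d (i, j))
          - (cmod (impedance D (i, j)))\<^sup>2 * current d (i, j))"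

definition base_feasible :: "('w, 'x) opf \<Rightarrow> ('w \<Rightarrow> nat \<Rightarrow> decision) \<Rightarrow> bool" where
  "base_feasible D y \<longleftrightarrow>
     (\<forall>\<omega>. y \<omega> \<in> trajectory_space D) \<and>
     (\<forall>\<omega>. \<forall>t\<le>horizon D.
        bounds_ok D (y \<omega> t) \<and> power_injection D (demand D \<omega> t) (y \<omega> t) \<and> branch_flow D (y \<omega> t)) \<and>
     (\<forall>\<omega>. storage_dynamics D (y \<omega>)) \<and>
     non_anticipative D y"

definition exact_current :: "('w, 'x) opf \<Rightarrow> ('w \<Rightarrow> nat \<Rightarrow> decision) \<Rightarrow> bool" where
  "exact_current D y \<longleftrightarrow>
     (\<forall>\<omega>. \<forall>t\<le>horizon D. \<forall>(i, j)\<in>edges D.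
        volt (y \<omega> t) i * current (y \<omega> t) (i, j) = (cmod (flow (y \<omega> t) (i, j)))\<^sup>2)"

definition soc_current :: "('w, 'x) opf \<Rightarrow> ('w \<Rightarrow> nat \<Rightarrow> decision) \<Rightarrow> bool" where
  "soc_current D y \<longleftrightarrow>
     (\<forall>\<omega>. \<forall>t\<le>horizon D. \<forall>(i, j)\<in>edges D.
        volt (y \<omega> t) i * current (y \<omega> t) (i, j) \<ge> (cmod (flow (y \<omega> t) (i, j)))\<^sup>2)"

text \<open>The linearized flow equations at one time step, for injections \<open>s\<close> at the non-slack buses.\<close>

definition lin_flow_eqs ::
  "('w, 'x) opf \<Rightarrow> (nat \<Rightarrow> complex) \<Rightarrow> (nat \<Rightarrow> real) \<Rightarrow> (nat \<times> nat \<Rightarrow> complex) \<Rightarrow> bool" where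
  "lin_flow_eqs D s v S \<longleftrightarrow>
     v 0 = 1 \<and>
     (\<forall>(i, j)\<in>edges D. S (i, j) = (\<Sum>k | (k, i) \<in> edges D. S (k, i)) + s i) \<and>
     (\<forall>(i, j)\<in>edges D. v i - v j = 2 * Re (cnj (impedance D (i, j)) * S (i, j)))"

definition lin_system ::
  "('w, 'x) opf \<Rightarrow> ('w \<Rightarrow> nat \<Rightarrow> decision) \<Rightarrow> ('w \<Rightarrow> nat \<Rightarrow> lin_state) \<Rightarrow> bool" where
  "lin_system D y L \<longleftrightarrow>
     (\<forall>\<omega>. L \<omega> \<in> lin_trajectory_space D) \<and>
     (\<forall>\<omega>. \<forall>t\<le>horizon D.
        lin_flow_eqs D (bus_power (y \<omega> t)) (lin_volt (L \<omega> t)) (lin_flow (L \<omega> t)) \<and>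
        0 = (\<Sum>k | (k, 0) \<in> edges D. lin_flow (L \<omega> t) (k, 0)) + lin_slack_power (L \<omega> t))"

definition lin_volt_bounded :: "('w, 'x) opf \<Rightarrow> (nat \<Rightarrow> real) \<Rightarrow> bool" where
  "lin_volt_bounded D v \<longleftrightarrow> (\<forall>i\<in>buses D. v i \<le> volt_max D i)"

definition lin_flow_sign :: "('w, 'x) opf \<Rightarrow> (nat \<times> nat \<Rightarrow> complex) \<Rightarrow> bool" where
  "lin_flow_sign D S \<longleftrightarrow>
     (\<forall>(i, j)\<in>edges D. \<forall>e\<in>subtree_edges D i. Re (cnj (impedance D e) * S (i, j)) \<le> 0)"

definition restriction ::
  "('w, 'x) opf \<Rightarrow> ('w \<Rightarrow> nat \<Rightarrow> decision) \<Rightarrow> ('w \<Rightarrow> nat \<Rightarrow> lin_state) \<Rightarrow> bool" where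
  "restriction D y L \<longleftrightarrow>
     lin_system D y L \<and>
     (\<forall>\<omega>. \<forall>t\<le>horizon D. lin_volt_bounded D (lin_volt (L \<omega> t)) \<and> lin_flow_sign D (lin_flow (L \<omega> t))) \<and>
     non_anticipative D L"

definition max_power :: "('w, 'x) opf \<Rightarrow> 'w \<Rightarrow> nat \<Rightarrow> nat \<Rightarrow> complex" where
  "max_power D \<omega> t i = of_real (p_inj_max D i) + \<i> * of_real (q_max D i) - demand D \<omega> t i"

definition feasible_P :: "('w, 'x) opf \<Rightarrow> ('w \<Rightarrow> nat \<Rightarrow> decision) set" where
  "feasible_P D = {y. base_feasible D y \<and> exact_current D y}"

definition feasible_PSOC :: "('w, 'x) opf \<Rightarrow> ('w \<Rightarrow> nat \<Rightarrow> decision) set" where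
  "feasible_PSOC D = {y. base_feasible D y \<and> soc_current D y}"

definition feasible_P' ::
  "('w, 'x) opf \<Rightarrow> (('w \<Rightarrow> nat \<Rightarrow> decision) \<times> ('w \<Rightarrow> nat \<Rightarrow> lin_state)) set" where
  "feasible_P' D = {(y, L). base_feasible D y \<and> exact_current D y \<and> restriction D y L}"

definition feasible_PSOC' ::
  "('w, 'x) opf \<Rightarrow> (('w \<Rightarrow> nat \<Rightarrow> decision) \<times> ('w \<Rightarrow> nat \<Rightarrow> lin_state)) set" where
  "feasible_PSOC' D = {(y, L). base_feasible D y \<and> soc_current D y \<and> restriction D y L}"

definition expected_cost :: "('w, 'x) opf \<Rightarrow> ('w \<Rightarrow> nat \<Rightarrow> decision) \<Rightarrow> real" where
  "expected_cost D y = measure_pmf.expectation (scenario_law D) (\<lambda>\<omega>. cost D \<omega> (y \<omega>))"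

definition val_P :: "('w, 'x) opf \<Rightarrow> ereal" where
  "val_P D = (INF y\<in>feasible_P D. ereal (expected_cost D y))"

definition val_PSOC :: "('w, 'x) opf \<Rightarrow> ereal" where
  "val_PSOC D = (INF y\<in>feasible_PSOC D. ereal (expected_cost D y))"

definition val_P' :: "('w, 'x) opf \<Rightarrow> ereal" where
  "val_P' D = (INF (y, L)\<in>feasible_P' D. ereal (expected_cost D y))"

definition val_PSOC' :: "('w, 'x) opf \<Rightarrow> ereal" where
  "val_PSOC' D = (INF (y, L)\<in>feasible_PSOC' D. ereal (expected_cost D y))"

end

theory Submission
  imports Defs
begin

text \<open>
  The linearized flow is monotone in the injections. On a rooted tree the power through the edge
  leaving a bus is the total injection of the subtree below that bus, so raising the real and
  imaginary parts of the injections raises those of every edge flow (\<open>lin_flow_mono\<close>). In a passive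
  network \<open>Re (cnj z * S) = Re z * Re S + Im z * Im S\<close> is nondecreasing in both parts of \<open>S\<close>, so
  every voltage drop along an edge increases as well, and summing the drops along the path to the
  root, where the voltage is pinned to 1, gives the same for the voltages (\<open>lin_volt_mono\<close>). The
  injections of any feasible point are dominated by the maximal ones, for which the voltage and sign
  bounds hold by hypothesis; hence the linearized flow of the feasible point satisfies these bounds
  too, and the restriction cuts off nothing (\<open>lin_system_imp_restriction\<close>).

  Existence of the linearized flow is a recursion from the leaves to the root for the powers, followed
  by one from the root to the leaves for the voltages; both recursions are well-founded because the
  network is a finite tree. Uniqueness comes from monotonicity applied in both directions.
  Uniqueness at a single time step also makes the linearized flow a function of the current
  injections alone, which is why it inherits non-anticipativity.
\<close>

section \<open>Rooted trees\<close>

lemma radial_edgeD: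
  assumes "radial_connected D" "(i, j) \<in> edges D"
  shows "i \<in> load_buses D" "i \<in> buses D" "j \<in> buses D" "i \<noteq> 0"
proof -
  show "i \<in> buses D" "j \<in> buses D"
    using assms by (auto simp: radial_connected_def)
  show "i \<noteq> 0"
    using assms by (cases "i = 0") (simp_all add: radial_connected_def)
  with \<open>i \<in> buses D\<close> show "i \<in> load_buses D"
    by (simp add: buses_def load_buses_def)
qed

lemma radial_parent_unique:
  assumes "radial_connected D" "(i, j) \<in> edges D" "(i, j') \<in> edges D"
  shows "j = j'"
proof -
  have "\<exists>!j. (i, j) \<in> edges D"
    using assms(1) radial_edgeD(1)[OF assms(1,2)] by (simp add: radial_connected_def)
  then show ?thesis
    using assms(2,3) by (auto elim!: ex1E)
qed

lemma radial_reaches_root: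
  assumes "radial_connected D" "i \<in> buses D"
  shows "(i, 0) \<in> (edges D)\<^sup>*"
  using assms by (simp add: radial_connected_def)

lemma radial_finite_edges:
  assumes "radial_connected D"
  shows "finite (edges D)"
  by (rule finite_subset[of _ "buses D \<times> buses D"])
    (use assms in \<open>simp_all add: radial_connected_def buses_def\<close>)

text \<open>
  Following parents is deterministic and ends at the root, which has no parent; a bus on a cycle
  would have its parent on the same cycle, and in the end the root.
\<close>

lemma radial_acyclic:
  assumes rad: "radial_connected D"
  shows "acyclic (edges D)"
proof -
  have no_cycle: "(i, i) \<notin> (edges D)\<^sup>+" if "(i, 0) \<in> (edges D)\<^sup>*" for i
    using that
  proof (induction rule: converse_rtrancl_induct)
    case base
    show ?case
      by (auto dest: tranclD radial_edgeD(4)[OF rad])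
  next
    case (step i j)
    show ?case
    proof
      assume "(i, i) \<in> (edges D)\<^sup>+"
      then obtain j' where j': "(i, j') \<in> edges D" "(j', i) \<in> (edges D)\<^sup>*"
        by (meson tranclD)
      have "j' = j"
        by (rule radial_parent_unique[OF rad j'(1) step.hyps(1)])
      with j'(2) step.hyps(1) have "(j, j) \<in> (edges D)\<^sup>+"
        by (simp add: rtrancl_into_trancl1)
      with step.IH show False ..
    qed
  qed
  show ?thesis
    unfolding acyclic_def
  proof (intro allI notI)
    fix i assume cycle: "(i, i) \<in> (edges D)\<^sup>+"
    then obtain j where "(i, j) \<in> edges D"
      by (meson tranclD)
    then have "(i, 0) \<in> (edges D)\<^sup>*"
      by (intro radial_reaches_root[OF rad] radial_edgeD(2)[OF rad])
    with cycle no_cycle show False by blast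
  qed
qed

lemma radial_wf:
  assumes "radial_connected D"
  shows "wf (edges D)" "wf ((edges D)\<inverse>)"
  using radial_finite_edges[OF assms] radial_acyclic[OF assms]
  by (simp_all add: finite_acyclic_wf finite_acyclic_wf_converse)

section \<open>Monotonicity of the linearized flow\<close>

lemma lin_flow_mono:
  assumes rad: "radial_connected D"
    and S: "lin_flow_eqs D s v S" and S': "lin_flow_eqs D s' v' S'"
    and le: "\<And>i. i \<in> load_buses D \<Longrightarrow> Re (s i) \<le> Re (s' i) \<and> Im (s i) \<le> Im (s' i)"
    and edge: "(i, j) \<in> edges D"
  shows "Re (S (i, j)) \<le> Re (S' (i, j)) \<and> Im (S (i, j)) \<le> Im (S' (i, j))"
  using edge
proof (induction i arbitrary: j rule: wf_induct_rule[OF radial_wf(1)[OF rad]])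
  case (1 i)
  have "S (i, j) = (\<Sum>k | (k, i) \<in> edges D. S (k, i)) + s i"
    and "S' (i, j) = (\<Sum>k | (k, i) \<in> edges D. S' (k, i)) + s' i"
    using S S' 1(2) unfolding lin_flow_eqs_def by blast+
  moreover have "Re (S (k, i)) \<le> Re (S' (k, i)) \<and> Im (S (k, i)) \<le> Im (S' (k, i))"
    if "(k, i) \<in> edges D" for k
    using 1(1)[OF that that] .
  ultimately show ?case
    using le[OF radial_edgeD(1)[OF rad 1(2)]] by (auto intro!: add_mono sum_mono)
qed

text \<open>
  Only the voltage drops are compared here, so that the lemma serves both a passive network with
  ordered flows and any network with equal flows.
\<close>

lemma lin_volt_mono:
  assumes rad: "radial_connected D"
    and S: "lin_flow_eqs D s v S" and S': "lin_flow_eqs D s' v' S'"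
    and drop: "\<And>e. e \<in> edges D \<Longrightarrow> Re (cnj (impedance D e) * S e) \<le> Re (cnj (impedance D e) * S' e)"
    and bus: "i \<in> buses D"
  shows "v i \<le> v' i"
proof -
  from radial_reaches_root[OF rad bus] show ?thesis
  proof (induction rule: converse_rtrancl_induct)
    case base
    show ?case
      using S S' unfolding lin_flow_eqs_def by simp
  next
    case (step i j)
    have "v i - v j = 2 * Re (cnj (impedance D (i, j)) * S (i, j))"
      and "v' i - v' j = 2 * Re (cnj (impedance D (i, j)) * S' (i, j))"
      using S S' step.hyps(1) unfolding lin_flow_eqs_def by blast+
    then show ?case
      using step.IH drop[OF step.hyps(1)] by linarith
  qed
qed

lemma passive_drop_mono:
  assumes "passive_network D" "e \<in> edges D" "Re a \<le> Re b" "Im a \<le> Im b"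
  shows "Re (cnj (impedance D e) * a) \<le> Re (cnj (impedance D e) * b)"
  using assms by (auto simp: passive_network_def intro!: add_mono mult_left_mono)

section \<open>Existence and uniqueness of the linearized flow\<close>

lemma lin_flow_eqs_exist:
  fixes D :: "('w, 'x) opf"
  assumes rad: "radial_connected D"
  obtains v S where "lin_flow_eqs D s v S"
proof -
  let ?E = "edges D"
  define parent where "parent i = (THE j. (i, j) \<in> ?E)" for i
  have parent: "parent i = j" if "(i, j) \<in> ?E" for i j
    unfolding parent_def using that radial_parent_unique[OF rad] by (intro the_equality)
  \<comment> \<open>\<open>F i\<close> is the power leaving bus \<open>i\<close>, accumulated from the leaves, which have an empty sum;
    \<open>v\<close> propagates from the root.\<close>
  define F where "F = wfrec ?E (\<lambda>f i. (\<Sum>k | (k, i) \<in> ?E. f k) + s i)"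
  define v where "v = wfrec (?E\<inverse>) (\<lambda>f i. if i = 0 then 1
    else f (parent i) + 2 * Re (cnj (impedance D (i, parent i)) * F i))"
  have F: "F i = (\<Sum>k | (k, i) \<in> ?E. F k) + s i" for i
    unfolding F_def by (subst wfrec[OF radial_wf(1)[OF rad]]) (simp add: cut_apply)
  have v_root: "v 0 = 1"
    unfolding v_def by (subst wfrec[OF radial_wf(2)[OF rad]]) simp
  have v_edge: "v i = v j + 2 * Re (cnj (impedance D (i, j)) * F i)" if "(i, j) \<in> ?E" for i j
    using that parent[OF that] radial_edgeD(4)[OF rad that]
    unfolding v_def by (subst wfrec[OF radial_wf(2)[OF rad]]) (simp add: cut_apply)
  have "lin_flow_eqs D s v (\<lambda>e. F (fst e))"
    unfolding lin_flow_eqs_def by (auto simp: v_root F[symmetric] dest: v_edge)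
  then show thesis
    by (rule that)
qed

text \<open>
  The linear system couples neither time steps nor scenarios; this is its restriction to a
  single time step and scenario.
\<close>

definition lin_solution :: "('w, 'x) opf \<Rightarrow> (nat \<Rightarrow> complex) \<Rightarrow> lin_state \<Rightarrow> bool" where
  "lin_solution D s l \<longleftrightarrow>
     l \<in> lin_state_space D \<and> lin_flow_eqs D s (lin_volt l) (lin_flow l) \<and>
     0 = (\<Sum>k | (k, 0) \<in> edges D. lin_flow l (k, 0)) + lin_slack_power l"

lemma lin_solution_exists:
  assumes rad: "radial_connected D"
  shows "\<exists>l. lin_solution D s l"
proof -
  obtain v S where vS: "lin_flow_eqs D s v S"
    using lin_flow_eqs_exist[OF rad] .
  \<comment> \<open>The equations only see buses and edges, so a solution may be cut off outside them.\<close>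
  define v' where "v' i = (if i \<in> buses D then v i else 0)" for i
  define S' where "S' e = (if e \<in> edges D then S e else 0)" for e
  have v': "v' i = v i" if "i \<in> buses D" for i
    using that by (simp add: v'_def)
  have S': "S' e = S e" if "e \<in> edges D" for e
    using that by (simp add: S'_def)
  have sum_S': "(\<Sum>k | (k, i) \<in> edges D. S' (k, i)) = (\<Sum>k | (k, i) \<in> edges D. S (k, i))" for i
    using S' by (intro sum.cong) auto
  have root: "0 \<in> buses D"
    by (simp add: buses_def)
  have "lin_flow_eqs D s v' S'"
    unfolding lin_flow_eqs_def sum_S'
  proof (intro conjI ballI, goal_cases)
    case 1
    show ?case
      using vS v'[OF root] by (simp add: lin_flow_eqs_def)
  next
    case (2 e)
    then show ?case
      using vS S'[OF 2] by (auto simp: lin_flow_eqs_def)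
  next
    case (3 e)
    then show ?case
      using vS S'[OF 3] v' radial_edgeD(2,3)[OF rad, of "fst e" "snd e"]
      by (auto simp: lin_flow_eqs_def)
  qed
  then have "lin_solution D s (Lin_State (- (\<Sum>k | (k, 0) \<in> edges D. S' (k, 0))) v' S')"
    by (simp add: lin_solution_def lin_state_space_def v'_def S'_def)
  then show ?thesis ..
qed

text \<open>
  Two solutions for the same injections dominate each other, by monotonicity in both directions;
  outside the index sets both are zero.
\<close>

lemma lin_solution_unique:
  assumes rad: "radial_connected D"
    and l: "lin_solution D s l" and l': "lin_solution D s l'"
  shows "l = l'"
proof -
  have eqs: "lin_flow_eqs D s (lin_volt l) (lin_flow l)" "lin_flow_eqs D s (lin_volt l') (lin_flow l')"
    and space: "l \<in> lin_state_space D" "l' \<in> lin_state_space D"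
    using l l' unfolding lin_solution_def by blast+
  have flow_edge: "lin_flow l e = lin_flow l' e" if "e \<in> edges D" for e
    using lin_flow_mono[OF rad eqs, of "fst e" "snd e"]
      lin_flow_mono[OF rad eqs(2,1), of "fst e" "snd e"] that
    by (simp add: complex_eq_iff)
  have flow: "lin_flow l = lin_flow l'"
  proof
    fix e show "lin_flow l e = lin_flow l' e"
      using flow_edge space by (cases e, cases "e \<in> edges D") (simp_all add: lin_state_space_def)
  qed
  have "lin_volt l = lin_volt l'"
  proof
    fix i show "lin_volt l i = lin_volt l' i"
    proof (cases "i \<in> buses D")
      case True
      then show ?thesis
        using lin_volt_mono[OF rad eqs] lin_volt_mono[OF rad eqs(2,1)] flow by (simp add: antisym)
    next
      case False
      then show ?thesis
        using space by (simp add: lin_state_space_def)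
    qed
  qed
  moreover have "lin_slack_power l = lin_slack_power l'"
    using l l' flow unfolding lin_solution_def by (metis add_left_cancel)
  ultimately show ?thesis
    using flow by (simp add: lin_state.expand)
qed

lemma lin_system_iff_lin_solution:
  "lin_system D y L \<longleftrightarrow>
     (\<forall>\<omega> t. if t \<le> horizon D then lin_solution D (bus_power (y \<omega> t)) (L \<omega> t)
       else L \<omega> t = Lin_State 0 0 0)"
  unfolding lin_system_def lin_trajectory_space_def lin_solution_def by (auto simp: not_le)

lemma lin_system_ex1:
  assumes rad: "radial_connected D"
  shows "\<exists>!L. lin_system D y L"
proof (rule ex_ex1I)
  let ?L = "\<lambda>\<omega> t. if t \<le> horizon D then SOME l. lin_solution D (bus_power (y \<omega> t)) l
    else Lin_State 0 0 0"
  have "lin_system D y ?L"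
    unfolding lin_system_iff_lin_solution using lin_solution_exists[OF rad] by (simp add: someI_ex)
  then show "\<exists>L. lin_system D y L"
    by (rule exI[of _ ?L])
next
  fix L L' assume "lin_system D y L" "lin_system D y L'"
  then have step: "if t \<le> horizon D
      then lin_solution D (bus_power (y \<omega> t)) (L \<omega> t) \<and> lin_solution D (bus_power (y \<omega> t)) (L' \<omega> t)
      else L \<omega> t = L' \<omega> t" for \<omega> t
    by (simp add: lin_system_iff_lin_solution)
  show "L = L'"
  proof (intro ext)
    fix \<omega> t show "L \<omega> t = L' \<omega> t"
      using step[of t \<omega>] lin_solution_unique[OF rad] by (cases "t \<le> horizon D") auto
  qed
qed

lemma lin_system_non_anticipative:
  assumes rad: "radial_connected D" and "non_anticipative D y" and sys: "lin_system D y L"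
  shows "non_anticipative D L"
  unfolding non_anticipative_def
proof (intro allI impI)
  fix t \<omega> \<omega>' assume t: "t \<le> horizon D" and "indistinguishable D t \<omega> \<omega>'"
  then have "y \<omega> t = y \<omega>' t"
    using assms(2) unfolding non_anticipative_def by blast
  moreover have "lin_solution D (bus_power (y w t)) (L w t)" for w
    using sys t by (simp add: lin_system_iff_lin_solution)
  ultimately show "L \<omega> t = L \<omega>' t"
    using lin_solution_unique[OF rad] by metis
qed

section \<open>The restriction is not binding\<close>

text \<open>Absorption only lowers the injected active power, so its largest value is attained without it.\<close>

lemma bus_power_le_max_power:
  assumes "bounds_ok D d" "power_injection D (demand D \<omega> t) d" "i \<in> load_buses D"
  shows "Re (bus_power d i) \<le> Re (max_power D \<omega> t i)" "Im (bus_power d i) \<le> Im (max_power D \<omega> t i)"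
proof -
  have "p_inj d i \<le> p_inj_max D i" "0 \<le> p_abs d i" "q_react d i \<le> q_max D i"
    using assms(1,3) unfolding bounds_ok_def by blast+
  moreover have
    "bus_power d i =
       of_real (p_inj d i) - of_real (p_abs d i) + \<i> * of_real (q_react d i) - demand D \<omega> t i"
    using assms(2,3) unfolding power_injection_def by blast
  ultimately show "Re (bus_power d i) \<le> Re (max_power D \<omega> t i)"
    "Im (bus_power d i) \<le> Im (max_power D \<omega> t i)"
    by (simp_all add: max_power_def)
qed

text \<open>
  Both bounds are upper bounds on quantities that increase with the injections, so they pass from
  any injections to smaller ones.
\<close>

lemma lin_bounds_of_dominated:
  assumes rad: "radial_connected D" and passive_net: "passive_network D"
    and S: "lin_flow_eqs D s v S" and S': "lin_flow_eqs D s' v' S'"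
    and le: "\<And>i. i \<in> load_buses D \<Longrightarrow> Re (s i) \<le> Re (s' i) \<and> Im (s i) \<le> Im (s' i)"
    and volt: "lin_volt_bounded D v'" and sign: "lin_flow_sign D S'"
  shows "lin_volt_bounded D v" "lin_flow_sign D S"
proof -
  \<comment> \<open>The impedance need not belong to the edge carrying the flow: the sign condition on \<open>(i, j)\<close>
    involves the impedances of all edges in the subtree of \<open>i\<close>.\<close>
  have drop: "Re (cnj (impedance D e) * S f) \<le> Re (cnj (impedance D e) * S' f)"
    if "e \<in> edges D" "f \<in> edges D" for e f
    using passive_drop_mono[OF passive_net that(1)] lin_flow_mono[OF rad S S' le] that(2)
    by (cases f) simp
  show "lin_volt_bounded D v"
    using lin_volt_mono[OF rad S S' drop] volt unfolding lin_volt_bounded_def by force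
  show "lin_flow_sign D S"
    unfolding lin_flow_sign_def
  proof (intro ballI, clarify)
    fix i j k l assume ij: "(i, j) \<in> edges D" and kl: "(k, l) \<in> subtree_edges D i"
    then have "(k, l) \<in> edges D" "Re (cnj (impedance D (k, l)) * S' (i, j)) \<le> 0"
      using sign unfolding lin_flow_sign_def subtree_edges_def by blast+
    with drop ij show "Re (cnj (impedance D (k, l)) * S (i, j)) \<le> 0"
      by (meson order_trans)
  qed
qed

lemma lin_system_imp_restriction:
  assumes rad: "radial_connected D" and passive_net: "passive_network D"
    and upper_flow: "\<And>\<omega> t. t \<le> horizon D \<Longrightarrow> lin_flow_eqs D (max_power D \<omega> t) (v_bar \<omega> t) (S_bar \<omega> t)"
    and upper_volt: "\<And>\<omega> t. t \<le> horizon D \<Longrightarrow> lin_volt_bounded D (v_bar \<omega> t)"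
    and upper_sign: "\<And>\<omega> t. t \<le> horizon D \<Longrightarrow> lin_flow_sign D (S_bar \<omega> t)"
    and feas: "base_feasible D y" and sys: "lin_system D y L"
  shows "restriction D y L"
proof -
  have "lin_volt_bounded D (lin_volt (L \<omega> t)) \<and> lin_flow_sign D (lin_flow (L \<omega> t))"
    if t: "t \<le> horizon D" for \<omega> t
  proof -
    have "bounds_ok D (y \<omega> t)" "power_injection D (demand D \<omega> t) (y \<omega> t)"
      using feas t unfolding base_feasible_def by blast+
    note le = bus_power_le_max_power[OF this]
    have "lin_flow_eqs D (bus_power (y \<omega> t)) (lin_volt (L \<omega> t)) (lin_flow (L \<omega> t))"
      using sys t unfolding lin_system_def by blast
    then show ?thesis
      using lin_bounds_of_dominated[OF rad passive_net _ upper_flow[OF t] _ upper_volt[OF t] upper_sign[OF t]]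
        le by blast
  qed
  moreover have "non_anticipative D L"
    using lin_system_non_anticipative[OF rad _ sys] feas unfolding base_feasible_def by blast
  ultimately show ?thesis
    using sys unfolding restriction_def by blast
qed

text \<open>
  The cost ignores the linearized flow, so the value of a restricted problem depends only on the
  projection of its feasible set to the original variables.
\<close>

lemma INF_eq_of_fst_image:
  assumes "fst ` B = A"
  shows "(INF y\<in>A. f y) = (INF (y, L)\<in>B. f y)"
  unfolding assms[symmetric] by (simp add: image_image case_prod_beta')

theorem proposition1:
  fixes D :: "('w::finite, 'x) opf"
    and v_bar :: "'w \<Rightarrow> nat \<Rightarrow> nat \<Rightarrow> real"
    and S_bar :: "'w \<Rightarrow> nat \<Rightarrow> nat \<times> nat \<Rightarrow> complex"
  assumes durations: "\<forall>t\<le>horizon D. duration D t > 0"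
    and cost: "convex_measurable_cost D"
    and radial: "radial_connected D"
    and passive_net: "passive_network D"
    and upper_flow: "\<forall>\<omega>. \<forall>t\<le>horizon D. lin_flow_eqs D (max_power D \<omega> t) (v_bar \<omega> t) (S_bar \<omega> t)"
    and upper_volt: "\<forall>\<omega>. \<forall>t\<le>horizon D. \<forall>i\<in>buses D. v_bar \<omega> t i \<le> volt_max D i"
    and upper_sign: "\<forall>\<omega>. \<forall>t\<le>horizon D. \<forall>(i, j)\<in>edges D. \<forall>(k, l)\<in>subtree_edges D i.
                       Re (cnj (impedance D (k, l)) * S_bar \<omega> t (i, j)) \<le> 0"
  shows "(\<forall>y\<in>feasible_P D. (\<exists>!L. lin_system D y L) \<and> (y, THE L. lin_system D y L) \<in> feasible_P' D) \<and>
         (\<forall>y\<in>feasible_PSOC D. (\<exists>!L. lin_system D y L) \<and> (y, THE L. lin_system D y L) \<in> feasible_PSOC' D) \<and>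
         val_P D = val_P' D \<and>
         val_PSOC D = val_PSOC' D"
proof -
  have restr: "restriction D y L" if "base_feasible D y" "lin_system D y L" for y L
    using lin_system_imp_restriction[OF radial passive_net _ _ _ that, of v_bar S_bar]
      upper_flow upper_volt upper_sign
    unfolding lin_volt_bounded_def lin_flow_sign_def by fast
  have ex1: "\<exists>!L. lin_system D y L" for y
    by (rule lin_system_ex1[OF radial])
  note the_sys = theI'[OF ex1]
  have P: "(y, THE L. lin_system D y L) \<in> feasible_P' D" if "y \<in> feasible_P D" for y
    using that restr[OF _ the_sys] by (simp add: feasible_P_def feasible_P'_def)
  have PSOC: "(y, THE L. lin_system D y L) \<in> feasible_PSOC' D" if "y \<in> feasible_PSOC D" for y
    using that restr[OF _ the_sys] by (simp add: feasible_PSOC_def feasible_PSOC'_def)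
  have "fst ` feasible_P' D = feasible_P D"
    using P by (force simp: feasible_P_def feasible_P'_def)
  then have "val_P D = val_P' D"
    unfolding val_P_def val_P'_def by (rule INF_eq_of_fst_image)
  moreover have "fst ` feasible_PSOC' D = feasible_PSOC D"
    using PSOC by (force simp: feasible_PSOC_def feasible_PSOC'_def)
  then have "val_PSOC D = val_PSOC' D"
    unfolding val_PSOC_def val_PSOC'_def by (rule INF_eq_of_fst_image)
  ultimately show ?thesis
    using ex1 P PSOC by blast
qed

end
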